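(* Let $D\subseteq\mathbb{C}$ be open, let $\varphi_2$ be a polynomial of degree $4$, let $\varphi_1$ be a non-constant analytic function on $D$, let $\alpha,\beta\in\mathbb{R}^{+}\setminus\{1\}$, and for $n=0,1,2,\dots$ let $\Theta_n(x)=\alpha^{\varphi_1(x)}\frac{d^n}{dx^n}\beta^{-\varphi_2(x)}$. Then for each $n\ge 0$ the function $y=\Theta_n(x)$ satisfies on $D$ the fourth order linear differential equation $$y^{(4)}+\left\{\ln\beta\,\varphi_2'-4\ln\alpha\,\varphi_1'\right\}y'''$$ $$+\left\{6(\ln\alpha)^2(\varphi_1')^2-3\ln\alpha\ln\beta\,\varphi_1'\varphi_2'-6\ln\alpha\,\varphi_1''+(n+3)\ln\beta\,\varphi_2''\right\}y''$$ $$+\Big\{-4(\ln\alpha)^3(\varphi_1')^3+3(\ln\alpha)^2\ln\beta\,\varphi_2'(\varphi_1')^2+12(\ln\alpha)^2\varphi_1'\varphi_1''-4\ln\alpha\,\varphi_1'''-3\ln\alpha\ln\beta\,\varphi_1''\varphi_2'$$ $$-2(n+3)\ln\alpha\ln\beta\,\varphi_2''\varphi_1'+\tfrac12(n+2)(n+3)\ln\beta\,\varphi_2'''\Big\}y'$$ $$+\Big\{(\ln\alpha)^4(\varphi_1')^4-(\ln\alpha)^3\ln\beta\,(\varphi_1')^3\varphi_2'-6(\ln\alpha)^3(\varphi_1')^2\varphi_1''+4(\ln\alpha)^2\varphi_1'\varphi_1'''+3(\ln\alpha)^2\ln\beta\,\varphi_1'\varphi_1''\varphi_2'$$ $$-\ln\alpha\ln\beta\,\varphi_1'''\varphi_2'+3(\ln\alpha)^2(\varphi_1'')^2-\ln\alpha\,\varphi_1^{(4)}+(n+3)(\ln\alpha)^2\ln\beta\,(\varphi_1')^2\varphi_2''-(n+3)\ln\alpha\ln\beta\,\varphi_1''\varphi_2''$$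 $$-\tfrac12(n+2)(n+3)\ln\alpha\ln\beta\,\varphi_1'\varphi_2'''+\tfrac16(n+1)(n+2)(n+3)\ln\beta\,\varphi_2^{(4)}\Big\}y=0,$$ where $\varphi_1,\varphi_2$ and their derivatives are evaluated at $x$.
   Context: For $c>0$ and $w\in\mathbb{C}$, $c^{w}=e^{w\ln c}$ with $\ln$ the real natural logarithm. Primes and the superscript $(4)$ denote derivatives with respect to $x$. *)

theory Defs
  imports "HOL-Complex_Analysis.Complex_Analysis"
begin

text \<open>
  For a positive real base, complex \<open>powr\<close> (defined via the principal branch of the logarithm)
  is \<open>c\<^sup>w = exp (w ln c)\<close> with the real natural logarithm:
\<close>

lemma of_real_powr_eq_exp_ln:
  fixes c :: real and w :: complex
  assumes "c > 0"
  shows "complex_of_real c powr w = exp (w * complex_of_real (ln c))"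
  using assms by (simp add: powr_def Ln_of_real)

definition Theta ::
    "real \<Rightarrow> real \<Rightarrow> (complex \<Rightarrow> complex) \<Rightarrow> complex poly \<Rightarrow> nat \<Rightarrow> complex \<Rightarrow> complex" where
  "Theta \<alpha> \<beta> \<phi>\<^sub>1 \<phi>\<^sub>2 n x =
     (complex_of_real \<alpha> powr \<phi>\<^sub>1 x) *
     (deriv ^^ n) (\<lambda>t. complex_of_real \<beta> powr (- poly \<phi>\<^sub>2 t)) x"

end

theory Submission
  imports Defs
begin

text \<open>
  With \<open>w = exp (- b \<phi>\<^sub>2)\<close>, differentiating \<open>w' = - b \<phi>\<^sub>2' w\<close> another
  \<open>n + 3\<close> times by Leibniz' rule gives a fourth order linear equation for \<open>u = w\<^bsup>(n)\<^esup>\<close>: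
  the sum stops after four terms because \<open>\<phi>\<^sub>2\<close> is quartic. Substituting
  \<open>u = exp (- a \<phi>\<^sub>1) y\<close> turns it into the equation for \<open>y = \<Theta>\<^sub>n\<close>.
\<close>

text \<open>Since \<open>exp (h w)\<close> has derivative \<open>deriv h w * exp (h w)\<close>,
  Leibniz' rule for n further derivatives of that product gives the sum. The result is a recursion
  in the derivatives of \<open>exp (h w)\<close> themselves. It serves both exponentials: the one
  with polynomial exponent and the gauge factor.\<close>

lemma higher_deriv_exp:
  fixes h :: "complex \<Rightarrow> complex"
  assumes "h holomorphic_on S" "open S" "z \<in> S"
  shows "(deriv ^^ Suc n) (\<lambda>w. exp (h w)) z =
    (\<Sum>i=0..n. of_nat (n choose i) * (deriv ^^ Suc i) h z * (deriv ^^ (n - i)) (\<lambda>w. exp (h w)) z)"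
proof -
  have "deriv (\<lambda>w. exp (h w)) x = deriv h x * exp (h x)" if "x \<in> S" for x
    using holomorphic_derivI[OF assms(1,2) that]
    by (intro DERIV_imp_deriv) (auto intro!: derivative_eq_intros)
  then have "(deriv ^^ n) (deriv (\<lambda>w. exp (h w))) z = (deriv ^^ n) (\<lambda>x. deriv h x * exp (h x)) z"
    using assms by (intro higher_deriv_transform_within_open[where S = S])
      (auto intro!: holomorphic_intros)
  also have "\<dots> = (\<Sum>i=0..n. of_nat (n choose i) * (deriv ^^ i) (deriv h) z
      * (deriv ^^ (n - i)) (\<lambda>w. exp (h w)) z)"
    using assms by (intro higher_deriv_mult[where S = S]) (auto intro!: holomorphic_intros)
  finally show ?thesis
    by (simp only: funpow_Suc_right o_apply)
qed

lemma higher_deriv_poly: "(deriv ^^ k) (poly p) = poly ((pderiv ^^ k) p)"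
  for p :: "complex poly"
proof (induction k)
  case (Suc k)
  then show ?case
    by (auto intro!: DERIV_imp_deriv poly_DERIV)
qed auto

lemma degree_higher_pderiv: "degree ((pderiv ^^ k) p) = degree p - k"
  for p :: "complex poly"
  by (induction k) (auto simp: degree_pderiv)

lemma higher_pderiv_eq_0:
  fixes p :: "complex poly"
  assumes "degree p < k"
  shows "(pderiv ^^ k) p = 0"
proof -
  \<comment> \<open>Degree 0 does not distinguish the zero polynomial from other constants. So the
    degree formula is applied one derivative earlier: the j-th derivative is constant, and the next
    one kills it.\<close>
  obtain j where k: "k = Suc j" "degree p \<le> j"
    using assms by (cases k) auto
  then have "degree ((pderiv ^^ j) p) = 0"
    by (simp add: degree_higher_pderiv)
  then show ?thesis
    by (simp add: k pderiv_eq_0_iff)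
qed

text \<open>The shift by 1 here, and by 2 in the cubic case, keeps the factors free of subtraction
  and lets the induction start at a vanishing binomial.\<close>

lemma of_nat_choose_2: "of_nat (m + 1 choose 2) = (1/2 :: complex) * of_nat m * (of_nat m + 1)"
  by (induction m) (auto simp: numeral_2_eq_2 field_simps)

lemma of_nat_choose_3:
  "of_nat (m + 2 choose 3) = (1/6 :: complex) * of_nat m * (of_nat m + 1) * (of_nat m + 2)"
proof (induction m)
  case (Suc m)
  \<comment> \<open>Pascal's rule, with \<open>m + 2\<close> written as \<open>m + 1 + 1\<close> to
    match the quadratic formula.\<close>
  have "of_nat (Suc m + 2 choose 3) = (of_nat (m + 1 + 1 choose 2) + of_nat (m + 2 choose 3) :: complex)"
    by (simp add: numeral_3_eq_3 numeral_2_eq_2)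
  then show ?case
    by (simp only: Suc of_nat_choose_2) (simp add: field_simps)
qed auto

lemma higher_deriv_exp_quartic:
  fixes p :: "complex poly" and c z :: complex and n :: nat
  assumes "degree p \<le> 4"
  defines "q \<equiv> \<lambda>k. (deriv ^^ k) (poly p) z"
    and "w \<equiv> \<lambda>k. (deriv ^^ k) (\<lambda>t. exp (c * poly p t)) z"
  shows "w (n + 4) = c * (q 1 * w (n + 3) + (of_nat n + 3) * q 2 * w (n + 2)
    + 1/2 * (of_nat n + 2) * (of_nat n + 3) * q 3 * w (n + 1)
    + 1/6 * (of_nat n + 1) * (of_nat n + 2) * (of_nat n + 3) * q 4 * w n)"
proof -
  let ?f = "\<lambda>i. of_nat (n + 3 choose i) * (c * q (Suc i)) * w (n + 3 - i)"
  have cq: "(deriv ^^ k) (\<lambda>t. c * poly p t) z = c * q k" for k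
    unfolding q_def by (rule higher_deriv_cmult[where A = UNIV]) (auto intro!: holomorphic_intros)
  have q0: "q k = 0" if "k > 4" for k
    using that assms(1) by (simp add: q_def higher_deriv_poly higher_pderiv_eq_0)
  have "w (Suc (n + 3)) = (\<Sum>i=0..n + 3. ?f i)"
    unfolding w_def
    by (subst higher_deriv_exp[where S = UNIV]) (auto simp only: cq open_UNIV UNIV_I intro!: holomorphic_intros)
  \<comment> \<open>For i > 3 the factor \<open>q (Suc i)\<close> is a derivative of order above 4,
    hence zero. All of 0..3 lies in the range even for n = 0. The binomials
    \<open>n + 3 choose i\<close> that remain are the source of the factors 1/2 and 1/6 in the
    equation.\<close>
  also have "\<dots> = (\<Sum>i\<in>{0..3}. ?f i)"
    by (intro sum.mono_neutral_right) (auto simp: q0)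
  also have "\<dots> = ?f 0 + ?f 1 + ?f 2 + ?f 3"
    by (simp add: numeral_3_eq_3 numeral_2_eq_2)
  finally have sum: "w (n + 4) = ?f 0 + ?f 1 + ?f 2 + ?f 3"
    by (simp add: eval_nat_numeral)
  have c2: "of_nat (n + 3 choose 2) = (1/2 :: complex) * (of_nat n + 2) * (of_nat n + 3)"
    using of_nat_choose_2[of "n + 2"] by (simp add: eval_nat_numeral add_ac)
  have c3: "of_nat (n + 3 choose 3) = (1/6 :: complex) * (of_nat n + 1) * (of_nat n + 2) * (of_nat n + 3)"
    using of_nat_choose_3[of "n + 1"] by (simp add: eval_nat_numeral add_ac)
  have w: "w (n + 3 - 0) = w (n + 3)" "w (n + 3 - 1) = w (n + 2)" "w (n + 3 - 2) = w (n + 1)"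
      "w (n + 3 - 3) = w n" "q (Suc 0) = q 1" "q (Suc 1) = q 2" "q (Suc 2) = q 3" "q (Suc 3) = q 4"
    by (simp_all add: eval_nat_numeral)
  show ?thesis
    unfolding sum c2 c3 w by (simp add: algebra_simps)
qed

text \<open>Conjugation by F = exp(a p) turns d/dx into d/dx - a p', and the coefficients of y are
  those of the conjugated operator. Derivatives are replaced by free ring elements: the
  \<open>f\<close> equations encode F' = a p' F, the \<open>y\<close> equations encode y = F u. What
  remains is a polynomial identity.\<close>

lemma quartic_ode_gauge:
  fixes a :: "'a::comm_ring_1"
  assumes u: "u4 + b1 * u3 + b2 * u2 + b3 * u1 + b4 * u0 = 0"
    and f: "f1 = a * p1 * f0" "f2 = a * p1 * f1 + a * p2 * f0"
      "f3 = a * p1 * f2 + 2 * a * p2 * f1 + a * p3 * f0"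
      "f4 = a * p1 * f3 + 3 * a * p2 * f2 + 3 * a * p3 * f1 + a * p4 * f0"
    and y: "y0 = f0 * u0" "y1 = f0 * u1 + f1 * u0" "y2 = f0 * u2 + 2 * f1 * u1 + f2 * u0"
      "y3 = f0 * u3 + 3 * f1 * u2 + 3 * f2 * u1 + f3 * u0"
      "y4 = f0 * u4 + 4 * f1 * u3 + 6 * f2 * u2 + 4 * f3 * u1 + f4 * u0"
  shows "y4 + (b1 - 4 * a * p1) * y3
    + (6 * a^2 * p1^2 - 3 * a * p1 * b1 - 6 * a * p2 + b2) * y2
    + (- 4 * a^3 * p1^3 + 3 * a^2 * p1^2 * b1 + 12 * a^2 * p1 * p2 - 4 * a * p3
       - 3 * a * p2 * b1 - 2 * a * p1 * b2 + b3) * y1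
    + (a^4 * p1^4 - a^3 * p1^3 * b1 - 6 * a^3 * p1^2 * p2 + 4 * a^2 * p1 * p3
       + 3 * a^2 * p1 * p2 * b1 - a * p3 * b1 + 3 * a^2 * p2^2 - a * p4
       + a^2 * p1^2 * b2 - a * p2 * b2 - a * p1 * b3 + b4) * y0 = 0" (is "?L = 0")
proof -
  \<comment> \<open>Unfolding \<open>f\<close> repeatedly leaves \<open>f0\<close> as a common
    factor; its cofactor is the left side of the equation for u.\<close>
  have "?L = f0 * (u4 + b1 * u3 + b2 * u2 + b3 * u1 + b4 * u0)"
    unfolding y f by (simp add: algebra_simps power2_eq_square power3_eq_cube power4_eq_xxxx)
  then show ?thesis
    by (simp add: u)
qed

theorem theorem7:
  fixes D :: "complex set" and \<phi>\<^sub>1 :: "complex \<Rightarrow> complex" and \<phi>\<^sub>2 :: "complex poly"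
    and \<alpha> \<beta> :: real and n :: nat
  assumes "open D"
    and "degree \<phi>\<^sub>2 = 4"
    and "\<phi>\<^sub>1 analytic_on D"
    and "\<not> \<phi>\<^sub>1 constant_on D"
    and "\<alpha> > 0" and "\<alpha> \<noteq> 1"
    and "\<beta> > 0" and "\<beta> \<noteq> 1"
  shows "Theta \<alpha> \<beta> \<phi>\<^sub>1 \<phi>\<^sub>2 n holomorphic_on D \<and>
    (\<forall>x\<in>D.
      let a = complex_of_real (ln \<alpha>);
          b = complex_of_real (ln \<beta>);
          N = (of_nat n :: complex);
          p = (\<lambda>k. (deriv ^^ k) \<phi>\<^sub>1 x);
          q = (\<lambda>k. (deriv ^^ k) (poly \<phi>\<^sub>2) x);
          y = (\<lambda>k. (deriv ^^ k) (Theta \<alpha> \<beta> \<phi>\<^sub>1 \<phi>\<^sub>2 n) x)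
      in
        y 4
        + (b * q 1 - 4 * a * p 1) * y 3
        + (6 * a^2 * (p 1)^2 - 3 * a * b * p 1 * q 1 - 6 * a * p 2 + (N + 3) * b * q 2) * y 2
        + (- 4 * a^3 * (p 1)^3 + 3 * a^2 * b * q 1 * (p 1)^2 + 12 * a^2 * p 1 * p 2
           - 4 * a * p 3 - 3 * a * b * p 2 * q 1
           - 2 * (N + 3) * a * b * q 2 * p 1
           + (1/2) * (N + 2) * (N + 3) * b * q 3) * y 1
        + (a^4 * (p 1)^4 - a^3 * b * (p 1)^3 * q 1 - 6 * a^3 * (p 1)^2 * p 2
           + 4 * a^2 * p 1 * p 3 + 3 * a^2 * b * p 1 * p 2 * q 1
           - a * b * p 3 * q 1 + 3 * a^2 * (p 2)^2 - a * p 4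
           + (N + 3) * a^2 * b * (p 1)^2 * q 2 - (N + 3) * a * b * p 2 * q 2
           - (1/2) * (N + 2) * (N + 3) * a * b * p 1 * q 3
           + (1/6) * (N + 1) * (N + 2) * (N + 3) * b * q 4) * y 0
        = 0)"
proof (intro conjI ballI, goal_cases)
  define a b where "a = complex_of_real (ln \<alpha>)" and "b = complex_of_real (ln \<beta>)"
  define F where "F = (\<lambda>x. exp (a * \<phi>\<^sub>1 x))"
  define W where "W = (\<lambda>x. exp (- b * poly \<phi>\<^sub>2 x))"
  have \<phi>: "\<phi>\<^sub>1 holomorphic_on D"
    using assms by (simp add: analytic_on_open)
  have Theta: "Theta \<alpha> \<beta> \<phi>\<^sub>1 \<phi>\<^sub>2 n = (\<lambda>x. F x * (deriv ^^ n) W x)"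
    using assms by (simp add: fun_eq_iff Theta_def of_real_powr_eq_exp_ln F_def W_def a_def b_def mult.commute)
  have F: "F holomorphic_on D"
    unfolding F_def by (intro holomorphic_intros \<phi>)
  have "W holomorphic_on UNIV"
    unfolding W_def by (intro holomorphic_intros)
  then have "(deriv ^^ n) W holomorphic_on UNIV"
    by (simp add: holomorphic_higher_deriv)
  then have Wn: "(deriv ^^ n) W holomorphic_on D"
    using holomorphic_on_subset by blast
  {
    case 1
    show ?case
      unfolding Theta by (intro holomorphic_intros F Wn)
  next
    case (2 x)
    note x = this
    define p where "p = (\<lambda>k. (deriv ^^ k) \<phi>\<^sub>1 x)"
    define q where "q = (\<lambda>k. (deriv ^^ k) (poly \<phi>\<^sub>2) x)"
    define f where "f = (\<lambda>k. (deriv ^^ k) F x)"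
    \<comment> \<open>Orders are counted from n, so that the relation between the derivatives of
      \<open>W\<close> of orders n to n + 4 reads as a fourth order equation for the n-th
      derivative.\<close>
    define u where "u = (\<lambda>k. (deriv ^^ (n + k)) W x)"
    define y where "y = (\<lambda>k. (deriv ^^ k) (Theta \<alpha> \<beta> \<phi>\<^sub>1 \<phi>\<^sub>2 n) x)"
    have u4: "u 4 = - b * (q 1 * u 3 + (of_nat n + 3) * q 2 * u 2
      + 1/2 * (of_nat n + 2) * (of_nat n + 3) * q 3 * u 1
      + 1/6 * (of_nat n + 1) * (of_nat n + 2) * (of_nat n + 3) * q 4 * u 0)"
      using higher_deriv_exp_quartic[of \<phi>\<^sub>2 n "- b" x] assms(2)
      by (simp add: u_def q_def W_def)
    have ode: "u 4 + (b * q 1) * u 3 + ((of_nat n + 3) * b * q 2) * u 2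
        + ((1/2) * (of_nat n + 2) * (of_nat n + 3) * b * q 3) * u 1
        + ((1/6) * (of_nat n + 1) * (of_nat n + 2) * (of_nat n + 3) * b * q 4) * u 0 = 0"
      unfolding u4 by (simp add: field_simps)
    have ap: "(deriv ^^ k) (\<lambda>t. a * \<phi>\<^sub>1 t) x = a * p k" for k
      unfolding p_def by (rule higher_deriv_cmult[where A = D]) (auto intro: \<phi> x assms)
    \<comment> \<open>The cases m = 0, 1, 2, 3 are the relations between the derivatives of F that
      the gauge lemma assumes.\<close>
    have f_Suc: "f (Suc m) = (\<Sum>i=0..m. of_nat (m choose i) * (a * p (Suc i)) * f (m - i))" for m
      unfolding f_def F_def
      by (subst higher_deriv_exp[where S = D]) (auto simp only: ap x assms(1) intro!: holomorphic_intros \<phi>)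
    have f1: "f 1 = a * p 1 * f 0"
      using f_Suc[of 0] by simp
    have f2: "f 2 = a * p 1 * f 1 + a * p 2 * f 0"
      using f_Suc[of 1] by (simp add: eval_nat_numeral)
    have f3: "f 3 = a * p 1 * f 2 + 2 * a * p 2 * f 1 + a * p 3 * f 0"
      using f_Suc[of 2] by (simp add: eval_nat_numeral)
    have f4: "f 4 = a * p 1 * f 3 + 3 * a * p 2 * f 2 + 3 * a * p 3 * f 1 + a * p 4 * f 0"
      using f_Suc[of 3] by (simp add: eval_nat_numeral)
    have y: "y k = (\<Sum>i=0..k. of_nat (k choose i) * f i * u (k - i))" for k
      using higher_deriv_mult[OF F Wn \<open>open D\<close> x]
      by (simp add: y_def Theta f_def u_def funpow_add add.commute[of n])
    have y0: "y 0 = f 0 * u 0"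
      by (simp add: y)
    have y1: "y 1 = f 0 * u 1 + f 1 * u 0"
      by (simp add: y)
    have y2: "y 2 = f 0 * u 2 + 2 * f 1 * u 1 + f 2 * u 0"
      by (simp add: y eval_nat_numeral)
    have y3: "y 3 = f 0 * u 3 + 3 * f 1 * u 2 + 3 * f 2 * u 1 + f 3 * u 0"
      by (simp add: y eval_nat_numeral)
    have y4: "y 4 = f 0 * u 4 + 4 * f 1 * u 3 + 6 * f 2 * u 2 + 4 * f 3 * u 1 + f 4 * u 0"
      by (simp add: y eval_nat_numeral)
    show ?case
      \<comment> \<open>Here \<open>b1\<close> to \<open>b4\<close> become the coefficients of
        \<open>ode\<close>; the outcome differs from the claim only in the order of factors.\<close>
      using quartic_ode_gauge[OF ode f1 f2 f3 f4 y0 y1 y2 y3 y4]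
      unfolding Let_def a_def b_def p_def q_def y_def by (simp only: mult_ac)
  }
qed

end
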